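(* Let $g\in\mathcal{G}_1$. For all $z,w\in\mathbb{C}$ the inequality $$|1-\exp C_g(z,w)|\le 1$$ holds. Moreover, it follows that equality holds in this inequality if and only if $g$ is the characteristic function of $\frac12\big((z-w)D_\theta+(z+w)\big)=\{\tfrac12((z-w)v+(z+w)) : v\in D_\theta\}$ for some $\theta\in(0,\pi)$.
   Context: $\mathcal{G}_1$ denotes the set of (almost-everywhere) equivalence classes of compactly supported (i.e. with compact essential support) bounded measurable functions $g$ on the complex plane $\mathbb{C}$ satisfying $0\le g\le 1$; equality of such functions is understood in this sense. Here $a$ denotes area (Lebesgue) measure on $\mathbb{C}$. For $g\in\mathcal{G}_1$ and $z\ne w$ in $\mathbb{C}$, $$C_g(z,w)=-\frac1\pi\int_{\mathbb{C}}\frac{g(u)}{\overline{(u-w)}\,(u-z)}\,da(u).$$ Convention on the diagonal: $\exp C_g(w,w)$ is defined to be $\exp\left(-\frac1\pi\int_{\mathbb{C}}\frac{g(u)}{|u-w|^2}\,da(u)\right)$ when $\frac1\pi\int_{\mathbb{C}}\frac{g(u)}{|u-w|^2}\,da(u)<\infty$, and $0$ when this integral is $+\infty$. For $0<\theta<\pi$, $D_\theta$ is the disc with center $i\cot\theta$ and radius $\csc\theta$.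
   Formalization: The equality characterization is stated only for z ≠ w; for z = w it is false as written, e.g. g = 0 is the characteristic function of the null set {w}, but |1 − exp C_g(w,w)| = 0. The inequality itself is stated for all z, w. *)

theory Defs
  imports "HOL-Analysis.Analysis"
begin

definition ess_support :: "(complex \<Rightarrow> real) \<Rightarrow> complex set" where
  "ess_support g = - \<Union>{U. open U \<and> (AE u in lebesgue. u \<in> U \<longrightarrow> g u = 0)}"

text \<open>
  Elements of the class are represented by functions, and all conditions are invariant under
  changing the function on a null set; equality in the class is equality almost everywhere.
\<close>

definition G1 :: "(complex \<Rightarrow> real) set" where
  "G1 = {g \<in> borel_measurable lebesgue.
           (AE u in lebesgue. 0 \<le> g u \<and> g u \<le> 1) \<and> compact (ess_support g)}"

definition C :: "(complex \<Rightarrow> real) \<Rightarrow> complex \<Rightarrow> complex \<Rightarrow> complex" where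
  "C g z w = - (1 / complex_of_real pi) *
     (LINT u|lebesgue. complex_of_real (g u) / (cnj (u - w) * (u - z)))"

text \<open>
  On the diagonal the Bochner integral would be \<open>0\<close> in the divergent case, so
  divergence is tested with the nonnegative integral and the value \<open>0\<close> is assigned explicitly.
\<close>

definition exp_C :: "(complex \<Rightarrow> real) \<Rightarrow> complex \<Rightarrow> complex \<Rightarrow> complex" where
  "exp_C g z w =
     (if z \<noteq> w then exp (C g z w)
      else if (\<integral>\<^sup>+ u. ennreal (g u / (cmod (u - w))\<^sup>2) \<partial>lebesgue) < \<infinity>
      then complex_of_real (exp (- (1 / pi) * (LINT u|lebesgue. g u / (cmod (u - w))\<^sup>2)))
      else 0)"

definition D :: "real \<Rightarrow> complex set" where
  "D \<theta> = ball (\<i> * complex_of_real (cot \<theta>)) (1 / sin \<theta>)"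

end

theory Submission
  imports Defs
begin

text \<open>
  Fix \<open>z \<noteq> w\<close>, write \<open>c = C g z w\<close>, and for \<open>0 < \<theta> < \<pi>\<close> let \<open>E\<^sub>\<theta>\<close> be the image of \<open>D \<theta>\<close> under
  \<open>v \<mapsto> ((z - w) v + (z + w)) / 2\<close>; these are exactly the discs whose boundary passes through both
  \<open>z\<close> and \<open>w\<close>. The proof views \<open>c\<close> as a linear function of \<open>g\<close> and asks how far it can reach in a
  given direction.

  For the unit vector \<open>\<mu> = sin \<theta> - \<i> cos \<theta>\<close> the function
  \<open>Re (- \<mu> / (cnj (u - w) * (u - z)))\<close> of \<open>u\<close> is positive on \<open>E\<^sub>\<theta>\<close> and negative outside its closure
  (lemma \<open>rotated_kernel_eq\<close>). Hence, among all weights \<open>g\<close> with values in \<open>[0, 1]\<close>,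
  the quantity \<open>Re (\<mu> * C g z w)\<close> is maximal precisely for the indicator function of \<open>E\<^sub>\<theta>\<close>, up to null sets.
  The maximum is explicit, because \<open>C\<close> of a disc with \<open>z\<close> and \<open>w\<close> on its boundary is a logarithm:
  \<open>C (indicator E\<^sub>\<theta>) z w = ln (2 sin \<theta>) + \<i> (\<pi>/2 - \<theta>)\<close> (lemma \<open>C_extremal_disc\<close>). This gives
  \<open>Re c * sin \<theta> + Im c * cos \<theta> \<le> ln (2 sin \<theta>) * sin \<theta> + (\<pi>/2 - \<theta>) * cos \<theta>\<close>
  for all \<open>0 < \<theta> < \<pi>\<close>,
  with equality for one \<open>\<theta>\<close> only if \<open>g\<close> is the indicator function of \<open>E\<^sub>\<theta>\<close>
  (lemma \<open>C_extremal_inequality\<close>).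

  These lines are the tangents to the concave curve \<open>a = ln (2 cos b)\<close>, \<open>\<bar>b\<bar> < \<pi>/2\<close>, so together
  they confine \<open>c = a + \<i> b\<close> to the region \<open>\<bar>b\<bar> < \<pi>/2\<close>, \<open>a \<le> ln (2 cos b)\<close>. On the strip
  \<open>\<bar>b\<bar> < \<pi>/2\<close> that region is the set where \<open>\<bar>1 - exp c\<bar> \<le> 1\<close>, and its boundary curve is where
  equality holds. If \<open>c\<close> is on the curve, then it is on the tangent with \<open>\<theta> = \<pi>/2 - b\<close>, so \<open>g\<close> is
  the indicator function of that \<open>E\<^sub>\<theta>\<close>; the converse is the explicit value of \<open>C\<close> on \<open>E\<^sub>\<theta>\<close>.

  The value of \<open>C\<close> on a disc comes from power series: by rotation invariance of area the monomials
  \<open>s^n\<close> are orthogonal on every disc centred at \<open>0\<close>, so expanding both factors of the kernel in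
  powers of \<open>s\<close> and \<open>cnj s\<close> leaves the series of a logarithm.

  On the diagonal \<open>exp_C g w w\<close> is a real number in \<open>[0, 1]\<close>, and the bound is immediate.
\<close>

section \<open>Rotations and radial functions in the plane\<close>

lemma lborel_complex_eq_distr_pair:
  "(lborel :: complex measure) = distr (lborel \<Otimes>\<^sub>M lborel) borel (\<lambda>p. Complex (fst p) (snd p))"
proof (rule lborel_eqI)
  have meas [measurable]: "(\<lambda>p. Complex (fst p) (snd p)) \<in> borel \<Otimes>\<^sub>M borel \<rightarrow>\<^sub>M borel"
    by (simp add: Complex_eq)
  fix l u :: complex
  assume le: "\<And>b. b \<in> Basis \<Longrightarrow> l \<bullet> b \<le> u \<bullet> b"
  have vim: "(\<lambda>p. Complex (fst p) (snd p)) -` box l u \<inter> space (lborel \<Otimes>\<^sub>M lborel)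
               = {Re l<..<Re u} \<times> {Im l<..<Im u}"
    by (auto simp: box_def Basis_complex_def inner_complex_def space_pair_measure)
  have "emeasure (distr (lborel \<Otimes>\<^sub>M lborel) borel (\<lambda>p. Complex (fst p) (snd p))) (box l u)
      = emeasure (lborel \<Otimes>\<^sub>M lborel) ({Re l<..<Re u} \<times> {Im l<..<Im u})"
    by (subst emeasure_distr) (auto simp: vim)
  also have "\<dots> = ennreal (Re u - Re l) * ennreal (Im u - Im l)"
    using le[of 1] le[of \<i>]
    by (subst lborel.emeasure_pair_measure_Times) (auto simp: Basis_complex_def inner_complex_def)
  also have "\<dots> = (\<Prod>b\<in>Basis. (u - l) \<bullet> b)"
    using le[of 1] le[of \<i>]
    by (simp add: Basis_complex_def inner_complex_def ennreal_mult)
  finally show "emeasure (distr (lborel \<Otimes>\<^sub>M lborel) borel (\<lambda>p. Complex (fst p) (snd p))) (box l u)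
      = (\<Prod>b\<in>Basis. (u - l) \<bullet> b)" .
qed simp

lemma nn_integral_lborel_complex:
  fixes f :: "complex \<Rightarrow> ennreal"
  assumes [measurable]: "f \<in> borel_measurable borel"
  shows "(\<integral>\<^sup>+ s. f s \<partial>lborel) = (\<integral>\<^sup>+ x. \<integral>\<^sup>+ y. f (Complex x y) \<partial>lborel \<partial>lborel)"
    and "(\<integral>\<^sup>+ s. f s \<partial>lborel) = (\<integral>\<^sup>+ y. \<integral>\<^sup>+ x. f (Complex x y) \<partial>lborel \<partial>lborel)"
proof -
  have meas [measurable]: "(\<lambda>p. Complex (fst p) (snd p)) \<in> borel \<Otimes>\<^sub>M borel \<rightarrow>\<^sub>M borel"
    by (simp add: Complex_eq)
  have "(\<integral>\<^sup>+ s. f s \<partial>lborel) = (\<integral>\<^sup>+ p. f (Complex (fst p) (snd p)) \<partial>(lborel \<Otimes>\<^sub>M lborel))"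
    by (subst lborel_complex_eq_distr_pair, subst nn_integral_distr)
       auto
  moreover have "\<dots> = (\<integral>\<^sup>+ x. \<integral>\<^sup>+ y. f (Complex x y) \<partial>lborel \<partial>lborel)"
    by (subst lborel.nn_integral_fst[symmetric]) auto
  moreover have "\<dots> = (\<integral>\<^sup>+ y. \<integral>\<^sup>+ x. f (Complex x y) \<partial>lborel \<partial>lborel)"
    by (subst lborel_pair.Fubini'[of "\<lambda>x y. f (Complex x y)"]) (auto simp: case_prod_beta')
  ultimately show "(\<integral>\<^sup>+ s. f s \<partial>lborel) = (\<integral>\<^sup>+ x. \<integral>\<^sup>+ y. f (Complex x y) \<partial>lborel \<partial>lborel)"
    and "(\<integral>\<^sup>+ s. f s \<partial>lborel) = (\<integral>\<^sup>+ y. \<integral>\<^sup>+ x. f (Complex x y) \<partial>lborel \<partial>lborel)"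
    by simp_all
qed

text \<open>
  A rotation by \<open>p + \<i> q\<close> with \<open>p \<noteq> 0\<close> is the composition of
  \<open>(x, y) \<mapsto> (p x - q y, y)\<close> and \<open>(x', y) \<mapsto> (x', (q x' + y) / p)\<close>. Each of them is affine in a single
  coordinate, so Fubini reduces them to substitutions on the line, whose factors \<open>1 / \<bar>p\<bar>\<close>
  and \<open>\<bar>p\<bar>\<close> cancel.
\<close>

lemma nn_integral_lborel_rotate_Re_nonzero:
  fixes f :: "complex \<Rightarrow> ennreal"
  assumes [measurable]: "f \<in> borel_measurable borel"
    and \<omega>: "cmod \<omega> = 1" "Re \<omega> \<noteq> 0"
  shows "(\<integral>\<^sup>+ s. f (\<omega> * s) \<partial>lborel) = (\<integral>\<^sup>+ s. f s \<partial>lborel)"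
proof -
  define p q where "p = Re \<omega>" and "q = Im \<omega>"
  have p: "p \<noteq> 0" and pq: "p * p + q * q = 1"
    using \<omega> by (auto simp: p_def q_def cmod_def power2_eq_square)
  have \<omega>_eq: "\<omega> = Complex p q" by (simp add: p_def q_def)
  have [measurable]: "(\<lambda>x. Complex (a x) (b x)) \<in> borel_measurable M"
    if [measurable]: "a \<in> borel_measurable M" "b \<in> borel_measurable M" for a b and M :: "'z measure"
    by (simp add: Complex_eq)
  let ?c = "ennreal \<bar>1 / p\<bar>"
  have "(\<integral>\<^sup>+ s. f (\<omega> * s) \<partial>lborel)
      = (\<integral>\<^sup>+ y. \<integral>\<^sup>+ x. f (Complex (p * x - q * y) (q * x + p * y)) \<partial>lborel \<partial>lborel)"
    by (subst nn_integral_lborel_complex(2)) (auto simp: \<omega>_eq complex_mult algebra_simps)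
  also have "\<dots> = (\<integral>\<^sup>+ y. ?c * (\<integral>\<^sup>+ x. f (Complex x ((q * x + y) / p)) \<partial>lborel) \<partial>lborel)"
  proof (rule nn_integral_cong)
    fix y
    have *: "q * (q * y / p + 1 / p * x) + p * y = (q * x + y) / p" for x
    proof -
      have "q * (q * y / p + 1 / p * x) + p * y = (q * x + (p * p + q * q) * y) / p"
        using p by (simp add: field_simps)
      then show ?thesis by (simp add: pq)
    qed
    have **: "p * (q * y / p + 1 / p * x) - q * y = x" for x
      using p by (simp add: field_simps)
    show "(\<integral>\<^sup>+ x. f (Complex (p * x - q * y) (q * x + p * y)) \<partial>lborel)
        = ?c * (\<integral>\<^sup>+ x. f (Complex x ((q * x + y) / p)) \<partial>lborel)"
      using p
      by (subst nn_integral_real_affine[where c = "1 / p" and t = "q * y / p"]) (simp_all only: * **, simp_all)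
  qed
  also have "\<dots> = ?c * (\<integral>\<^sup>+ y. \<integral>\<^sup>+ x. f (Complex x ((q * x + y) / p)) \<partial>lborel \<partial>lborel)"
    by (rule nn_integral_cmult) measurable
  also have "(\<integral>\<^sup>+ y. \<integral>\<^sup>+ x. f (Complex x ((q * x + y) / p)) \<partial>lborel \<partial>lborel)
           = (\<integral>\<^sup>+ x. \<integral>\<^sup>+ y. f (Complex x ((q * x + y) / p)) \<partial>lborel \<partial>lborel)"
    by (rule lborel_pair.Fubini') measurable
  also have "\<dots> = (\<integral>\<^sup>+ x. ennreal \<bar>p\<bar> * (\<integral>\<^sup>+ y. f (Complex x y) \<partial>lborel) \<partial>lborel)"
  proof (rule nn_integral_cong)
    fix x
    show "(\<integral>\<^sup>+ y. f (Complex x ((q * x + y) / p)) \<partial>lborel)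
        = ennreal \<bar>p\<bar> * (\<integral>\<^sup>+ y. f (Complex x y) \<partial>lborel)"
      using p by (subst nn_integral_real_affine[where c = p and t = "- q * x"]) auto
  qed
  also have "\<dots> = ennreal \<bar>p\<bar> * (\<integral>\<^sup>+ s. f s \<partial>lborel)"
    by (subst nn_integral_lborel_complex(1), simp, rule nn_integral_cmult) measurable
  also have "?c * \<dots> = (\<integral>\<^sup>+ s. f s \<partial>lborel)"
    using p by (simp add: mult.assoc[symmetric] ennreal_mult[symmetric] abs_mult[symmetric])
  finally show ?thesis .
qed

lemma lborel_complex_distr_rotate:
  assumes \<omega>: "cmod \<omega> = 1"
  shows "distr lborel borel (\<lambda>s. \<omega> * s) = (lborel :: complex measure)"
proof -
  have nn: "(\<integral>\<^sup>+ s. f (\<omega> * s) \<partial>lborel) = (\<integral>\<^sup>+ s. f s \<partial>lborel)"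
    if [measurable]: "f \<in> borel_measurable borel" for f :: "complex \<Rightarrow> ennreal"
  proof (cases "Re \<omega> = 0")
    case True
    \<comment> \<open>A quarter turn is split into two rotations with nonzero real part.\<close>
    define \<alpha> where "\<alpha> = Complex (3/5) (4/5)"
    have \<alpha>: "cmod \<alpha> = 1"
      by (simp add: \<alpha>_def cmod_def power2_eq_square)
    have "Im \<omega> \<noteq> 0" using True \<omega> by (auto simp: cmod_def)
    then have "Re (\<omega> * cnj \<alpha>) \<noteq> 0" using True by (simp add: \<alpha>_def)
    moreover have "cmod (\<omega> * cnj \<alpha>) = 1" by (simp add: norm_mult \<alpha> \<omega>)
    ultimately have "(\<integral>\<^sup>+ s. f (\<alpha> * (\<omega> * cnj \<alpha> * s)) \<partial>lborel) = (\<integral>\<^sup>+ s. f (\<alpha> * s) \<partial>lborel)"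
      by (intro nn_integral_lborel_rotate_Re_nonzero[of "\<lambda>s. f (\<alpha> * s)" "\<omega> * cnj \<alpha>"]) auto
    moreover have "\<alpha> * (\<omega> * cnj \<alpha> * s) = \<omega> * s" for s
    proof -
      have "\<alpha> * cnj \<alpha> = 1" using \<alpha> by (simp add: complex_norm_square[symmetric])
      then show ?thesis by (metis mult.assoc mult.commute mult.left_neutral)
    qed
    ultimately have "(\<integral>\<^sup>+ s. f (\<omega> * s) \<partial>lborel) = (\<integral>\<^sup>+ s. f (\<alpha> * s) \<partial>lborel)"
      by simp
    also have "\<dots> = (\<integral>\<^sup>+ s. f s \<partial>lborel)"
      by (rule nn_integral_lborel_rotate_Re_nonzero) (auto simp: \<alpha>, simp add: \<alpha>_def)
    finally show ?thesis .
  qed (use nn_integral_lborel_rotate_Re_nonzero \<omega> in auto)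
  show ?thesis
  proof (rule measure_eqI)
    fix A :: "complex set"
    assume "A \<in> sets (distr lborel borel (\<lambda>s. \<omega> * s))"
    then have [measurable]: "A \<in> sets borel" by simp
    have "emeasure (distr lborel borel (\<lambda>s. \<omega> * s)) A
        = (\<integral>\<^sup>+ s. indicator A s \<partial>distr lborel borel (\<lambda>s. \<omega> * s))"
      by simp
    also have "\<dots> = (\<integral>\<^sup>+ s. indicator A (\<omega> * s) \<partial>lborel)"
      by (rule nn_integral_distr) auto
    also have "\<dots> = emeasure lborel A"
      by (subst nn) auto
    finally show "emeasure (distr lborel borel (\<lambda>s. \<omega> * s)) A = emeasure lborel A" .
  qed simp
qed

text \<open>
  A disc of radius \<open>\<rho>\<close> has area \<open>\<pi> \<rho>\<^sup>2\<close>, so the squared modulus is uniformly distributed on a disc.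
  In this form the lemma does the work of polar coordinates for radial integrands.
\<close>

lemma distr_norm_square_disc:
  assumes r: "0 \<le> r"
  shows "distr (density lborel (indicator (ball 0 r))) borel (\<lambda>s::complex. (cmod s)\<^sup>2)
       = density lborel (\<lambda>x. ennreal pi * indicator {0<..<r\<^sup>2} x)"
    (is "?M = ?N")
proof (rule measure_eqI_lessThan)
  have M: "emeasure ?M {x<..} = emeasure lborel (ball 0 r \<inter> {s::complex. x < (cmod s)\<^sup>2})" for x
  proof -
    have "emeasure ?M {x<..}
        = emeasure (density lborel (indicator (ball (0::complex) r))) {s. x < (cmod s)\<^sup>2}"
      by (subst emeasure_distr) (auto simp: vimage_def)
    also have "\<dots> = emeasure lborel (ball 0 r \<inter> {s::complex. x < (cmod s)\<^sup>2})"
      by (subst emeasure_density)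
         (simp_all add: indicator_inter_arith[symmetric] borel_measurable_indicator)
    finally show ?thesis .
  qed
  have N: "emeasure ?N {x<..} = ennreal pi * emeasure lborel ({0<..<r\<^sup>2} \<inter> {x<..})" for x
    by (subst emeasure_density)
       (auto simp: mult.assoc indicator_inter_arith[symmetric] nn_integral_cmult)
  have disc: "emeasure lborel (ball 0 \<rho> :: complex set) = ennreal (pi * \<rho>\<^sup>2)"
             "emeasure lborel (cball 0 \<rho> :: complex set) = ennreal (pi * \<rho>\<^sup>2)" if "0 \<le> \<rho>" for \<rho>
    using that by (auto simp: emeasure_ball emeasure_cball unit_ball_vol_2)
  show eq: "emeasure ?M {x<..} = emeasure ?N {x<..}" for x
  proof -
    consider "x < 0" | "0 \<le> x" "x \<le> r\<^sup>2" | "r\<^sup>2 < x" by linarith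
    then show ?thesis
    proof cases
      case 1
      then have "ball 0 r \<inter> {s::complex. x < (cmod s)\<^sup>2} = ball 0 r"
        by (auto intro: less_le_trans)
      moreover have "{0<..<r\<^sup>2} \<inter> {x<..} = {0<..<r\<^sup>2}" using 1 by auto
      ultimately show ?thesis unfolding M N
        using r by (simp add: disc ennreal_mult)
    next
      case 2
      have "ball 0 r \<inter> {s::complex. x < (cmod s)\<^sup>2} = ball 0 r - cball 0 (sqrt x)"
      proof -
        have "cmod s \<le> sqrt x \<longleftrightarrow> (cmod s)\<^sup>2 \<le> x" for s
          using real_sqrt_le_iff[of "(cmod s)\<^sup>2" x] by simp
        then show ?thesis by auto
      qed
      moreover have "{0<..<r\<^sup>2} \<inter> {x<..} = {x<..<r\<^sup>2}" using 2 by auto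
      moreover have "emeasure lborel (ball 0 r - cball 0 (sqrt x) :: complex set)
                   = ennreal (pi * r\<^sup>2) - ennreal (pi * x)"
      proof (cases "x = r\<^sup>2")
        case True
        have empty: "ball 0 r - cball 0 (sqrt x) = ({} :: complex set)" using True r by auto
        show ?thesis unfolding empty using True by simp
      next
        case False
        have "sqrt x < r" using 2 False r by (simp add: real_less_lsqrt)
        then have "cball 0 (sqrt x) \<subseteq> (ball 0 r :: complex set)" by auto
        then show ?thesis using 2 r by (subst emeasure_Diff) (auto simp: disc)
      qed
      ultimately show ?thesis unfolding M N
        using 2 r by (simp add: ennreal_minus ennreal_mult'[symmetric] right_diff_distrib)
    next
      case 3
      have "ball 0 r \<inter> {s::complex. x < (cmod s)\<^sup>2} = {}"
      proof -
        have "(cmod s)\<^sup>2 \<le> r\<^sup>2" if "cmod s < r" for s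
          using that by (intro power_mono) auto
        then show ?thesis using 3 by force
      qed
      moreover have "{0<..<r\<^sup>2} \<inter> {x<..} = {}" using 3 by auto
      ultimately show ?thesis unfolding M N by simp
    qed
  qed
  show "emeasure ?M {x<..} < \<infinity>" for x
    unfolding M
    by (rule le_less_trans[OF emeasure_mono[of _ "ball 0 r"]]) (use r in \<open>auto simp: disc\<close>)
qed auto

section \<open>Orthogonality of monomials and the kernel on discs\<close>

lemma borel_measurable_cnj [measurable (raw)]:
  assumes "f \<in> borel_measurable M"
  shows "(\<lambda>x. cnj (f x)) \<in> borel_measurable M"
  using borel_measurable_continuous_on[OF continuous_on_cnj[OF continuous_on_id] assms] by simp

lemma nn_integral_radial_disc:
  fixes f :: "real \<Rightarrow> ennreal"
  assumes r: "0 \<le> r" and [measurable]: "f \<in> borel_measurable borel"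
  shows "(\<integral>\<^sup>+ s. indicator (ball 0 r) s * f ((cmod s)\<^sup>2) \<partial>lborel)
       = ennreal pi * (\<integral>\<^sup>+ x. indicator {0<..<r\<^sup>2} x * f x \<partial>lborel)"
proof -
  have [measurable]: "indicator (ball (0::complex) r) \<in> borel_measurable borel"
    by (rule borel_measurable_indicator) simp
  have "(\<integral>\<^sup>+ s. indicator (ball 0 r) s * f ((cmod s)\<^sup>2) \<partial>lborel)
      = (\<integral>\<^sup>+ s. f ((cmod s)\<^sup>2) \<partial>density lborel (indicator (ball (0::complex) r)))"
    by (subst nn_integral_density) auto
  also have "\<dots> = (\<integral>\<^sup>+ x. f x \<partial>distr (density lborel (indicator (ball 0 r))) borel (\<lambda>s::complex. (cmod s)\<^sup>2))"
    by (subst nn_integral_distr) auto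
  also have "\<dots> = (\<integral>\<^sup>+ x. f x \<partial>density lborel (\<lambda>x. ennreal pi * indicator {0<..<r\<^sup>2} x))"
    by (simp only: distr_norm_square_disc[OF r])
  also have "\<dots> = (\<integral>\<^sup>+ x. ennreal pi * indicator {0<..<r\<^sup>2} x * f x \<partial>lborel)"
    by (subst nn_integral_density) auto
  also have "\<dots> = ennreal pi * (\<integral>\<^sup>+ x. indicator {0<..<r\<^sup>2} x * f x \<partial>lborel)"
    by (subst nn_integral_cmult[symmetric]) (auto simp: mult.assoc)
  finally show ?thesis .
qed

lemma integrable_bounded_on_disc:
  fixes h :: "complex \<Rightarrow> complex"
  assumes [measurable]: "h \<in> borel_measurable borel" and "\<And>s. cmod s < r \<Longrightarrow> cmod (h s) \<le> B"
  shows "integrable lborel (\<lambda>s. indicator (ball 0 r) s *\<^sub>R h s)"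
proof (rule integrableI_bounded_set[where A = "ball 0 r" and B = B])
  show "emeasure lborel (ball 0 r :: complex set) < \<infinity>"
    by (cases "r \<ge> 0") (auto simp: emeasure_ball ball_empty)
qed (use assms in \<open>auto simp: indicator_def\<close>)

text \<open>
  Off the diagonal, rotation by \<open>cis t\<close> multiplies the integrand by \<open>cis ((n - m) t)\<close> and preserves the
  disc; for \<open>t = \<pi> / (n - m)\<close> the integral equals its own negative. On the diagonal the integrand is
  a power of \<open>\<bar>s\<bar>\<^sup>2\<close>.
\<close>

lemma disc_moment:
  assumes r: "0 \<le> r"
  shows "(LINT s|lborel. indicator (ball 0 r) s *\<^sub>R (cnj s ^ m * s ^ n))
       = (if m = n then complex_of_real (pi * (r\<^sup>2) ^ Suc n / real (Suc n)) else 0)"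
proof (cases "m = n")
  case True
  have "(\<integral>\<^sup>+ x. indicator {0<..<r\<^sup>2} x * ennreal (x ^ n) \<partial>lborel)
      = (\<integral>\<^sup>+ x. ennreal (x ^ n) * indicator {0..r\<^sup>2} x \<partial>lborel)"
    by (rule nn_integral_cong_AE, use AE_lborel_singleton[of 0] AE_lborel_singleton[of "r\<^sup>2"] in eventually_elim)
       (auto simp: indicator_def)
  also have "\<dots> = ennreal ((r\<^sup>2) ^ Suc n / real (Suc n) - 0 ^ Suc n / real (Suc n))"
    by (rule nn_integral_FTC_Icc) (auto intro!: derivative_eq_intros simp del: power_Suc of_nat_Suc)
  finally have x: "(\<integral>\<^sup>+ x. indicator {0<..<r\<^sup>2} x * ennreal (x ^ n) \<partial>lborel)
      = ennreal ((r\<^sup>2) ^ Suc n / real (Suc n))" by simp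
  have "(LINT s|lborel. indicator (ball 0 r) s * ((cmod s)\<^sup>2) ^ n)
      = enn2real (\<integral>\<^sup>+ s. ennreal (indicator (ball (0::complex) r) s * ((cmod s)\<^sup>2) ^ n) \<partial>lborel)"
    by (rule integral_eq_nn_integral) (measurable, auto)
  also have "(\<integral>\<^sup>+ s. ennreal (indicator (ball (0::complex) r) s * ((cmod s)\<^sup>2) ^ n) \<partial>lborel)
      = (\<integral>\<^sup>+ s. indicator (ball (0::complex) r) s * ennreal (((cmod s)\<^sup>2) ^ n) \<partial>lborel)"
    by (intro nn_integral_cong) (auto simp: indicator_def)
  also have "\<dots> = ennreal pi * ennreal ((r\<^sup>2) ^ Suc n / real (Suc n))"
    by (subst nn_integral_radial_disc[OF r, of "\<lambda>x. ennreal (x ^ n)"]) (simp_all only: x, simp)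
  also have "\<dots> = ennreal (pi * (r\<^sup>2) ^ Suc n / real (Suc n))"
    by (simp add: ennreal_mult'[symmetric])
  also have "enn2real \<dots> = pi * (r\<^sup>2) ^ Suc n / real (Suc n)"
    by (rule enn2real_ennreal) simp
  finally have real: "(LINT s|lborel. indicator (ball 0 r) s * ((cmod s)\<^sup>2) ^ n)
      = pi * (r\<^sup>2) ^ Suc n / real (Suc n)" .
  have "(LINT s|lborel. indicator (ball 0 r) s *\<^sub>R (cnj s ^ m * s ^ n))
      = (LINT s|lborel. complex_of_real (indicator (ball 0 r) s * ((cmod s)\<^sup>2) ^ n))"
  proof (rule Bochner_Integration.integral_cong[OF refl])
    fix s :: complex
    have "cnj s ^ n * s ^ n = complex_of_real (((cmod s)\<^sup>2) ^ n)"
    proof -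
      have "complex_of_real (((cmod s)\<^sup>2) ^ n) = (complex_of_real ((cmod s)\<^sup>2)) ^ n"
        by (rule of_real_power)
      also have "\<dots> = (s * cnj s) ^ n"
        by (simp only: complex_norm_square)
      finally show ?thesis by (simp only: power_mult_distrib mult.commute)
    qed
    then show "indicator (ball 0 r) s *\<^sub>R (cnj s ^ m * s ^ n)
        = complex_of_real (indicator (ball 0 r) s * ((cmod s)\<^sup>2) ^ n)"
      using True by (simp add: scaleR_conv_of_real)
  qed
  then show ?thesis using True real by (simp only: integral_complex_of_real if_True simp_thms)
next
  case False
  define d where "d = real n - real m"
  have d: "d \<noteq> 0" using False by (simp add: d_def)
  define \<omega> where "\<omega> = cis (pi / d)"
  have "cnj \<omega> ^ m * \<omega> ^ n = cis (real n * (pi / d) - real m * (pi / d))"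
    by (simp add: \<omega>_def cis_cnj Complex.DeMoivre cis_mult)
  also have "real n * (pi / d) - real m * (pi / d) = pi"
    using d by (simp only: left_diff_distrib[symmetric] d_def[symmetric]) simp
  finally have \<omega>: "cnj \<omega> ^ m * \<omega> ^ n = - 1" by simp
  let ?f = "\<lambda>s. indicator (ball 0 r) s *\<^sub>R (cnj s ^ m * s ^ n)"
  have [measurable]: "ball (0::complex) r \<in> sets borel" by simp
  have n\<omega>: "cmod \<omega> = 1" by (simp add: \<omega>_def)
  have "integral\<^sup>L lborel ?f = integral\<^sup>L (distr lborel borel (\<lambda>s. \<omega> * s)) ?f"
    by (simp only: lborel_complex_distr_rotate[OF n\<omega>])
  also have "\<dots> = (LINT s|lborel. ?f (\<omega> * s))"
    by (rule integral_distr) measurable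
  also have "\<dots> = (LINT s|lborel. - ?f s)"
  proof (rule Bochner_Integration.integral_cong[OF refl])
    fix s
    have "cnj (\<omega> * s) ^ m * (\<omega> * s) ^ n = (cnj \<omega> ^ m * \<omega> ^ n) * (cnj s ^ m * s ^ n)"
      by (simp add: power_mult_distrib)
    moreover have "indicator (ball 0 r) (\<omega> * s) = (indicator (ball 0 r) s :: real)"
      by (simp add: indicator_def norm_mult n\<omega>)
    ultimately show "?f (\<omega> * s) = - ?f s" by (simp add: \<omega>)
  qed
  also have "\<dots> = - integral\<^sup>L lborel ?f" by simp
  finally show ?thesis using False by simp
qed

text \<open>
  For \<open>\<bar>s\<bar> < r\<close> the factors \<open>1 / (Z - s)\<close> and \<open>1 / cnj (W - s)\<close> are limits of their geometric partial
  sums, which are bounded uniformly in \<open>s\<close>. By orthogonality the integral of the product of two partial sums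
  is a partial sum of \<open>\<pi> \<Sum> q^(n+1) / (n+1) = - \<pi> Ln (1 - q)\<close> with \<open>q = r\<^sup>2 / (cnj W * Z)\<close>.
\<close>

lemma integral_disc_kernel_outside:
  assumes r: "0 \<le> r" "r < cmod Z" "r < cmod W"
  shows "(LINT s|lborel. indicator (ball 0 r) s *\<^sub>R (1 / (cnj (s - W) * (s - Z))))
       = - complex_of_real pi * Ln (1 - complex_of_real (r\<^sup>2) / (cnj W * Z))"
proof -
  have [measurable]: "ball (0::complex) r \<in> sets borel" by simp
  define P where "P V N s = (\<Sum>n<N. s ^ n / V ^ Suc n)" for V s :: complex and N
  have P_meas [measurable]: "P V N \<in> borel_measurable borel" for V N
    unfolding P_def by measurable
  have P_lim: "(\<lambda>N. P V N s) \<longlonglongrightarrow> 1 / (V - s)" if "cmod s < cmod V" for V s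
  proof -
    have "V \<noteq> 0" using that by auto
    have "(\<lambda>n. (s / V) ^ n / V) sums (1 / (1 - s / V) / V)"
      by (intro sums_divide geometric_sums) (use that in \<open>auto simp: norm_divide divide_simps\<close>)
    also have "(\<lambda>n. (s / V) ^ n / V) = (\<lambda>n. s ^ n / V ^ Suc n)"
      by (simp add: power_divide mult.commute)
    also have "1 / (1 - s / V) / V = 1 / (V - s)"
    proof -
      have "(1 - s / V) * V = V - s" using \<open>V \<noteq> 0\<close> by (simp add: algebra_simps)
      then show ?thesis by (simp only: divide_divide_eq_left)
    qed
    finally show ?thesis by (simp add: sums_def P_def)
  qed
  have P_bound: "cmod (P V N s) \<le> 1 / (cmod V - r)" if "cmod s < r" "r < cmod V" for V N s
  proof -
    have V: "cmod V > 0" using that norm_ge_zero[of s] by linarith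
    have rV: "r / cmod V < 1" "0 \<le> r / cmod V" using V that r by auto
    have "cmod (P V N s) \<le> (\<Sum>n<N. r ^ n / cmod V ^ Suc n)"
      unfolding P_def
      by (rule sum_norm_le) (use that r in \<open>auto simp: norm_divide norm_power norm_mult intro!: divide_right_mono power_mono\<close>)
    also have "\<dots> = (\<Sum>n<N. (r / cmod V) ^ n / cmod V)"
      by (simp add: power_divide mult.commute)
    also have "\<dots> \<le> (\<Sum>n. (r / cmod V) ^ n / cmod V)"
      by (rule sum_le_suminf) (use rV r in \<open>auto intro!: summable_divide summable_geometric\<close>)
    also have "\<dots> = 1 / (1 - r / cmod V) / cmod V"
      using sums_divide[OF geometric_sums[of "r / cmod V"], of "cmod V"] rV
      by (simp add: sums_iff)
    also have "\<dots> = 1 / (cmod V - r)"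
      using V that by (simp add: field_simps)
    finally show ?thesis .
  qed
  define q where "q = complex_of_real (r\<^sup>2) / (cnj W * Z)"
  have nz: "Z \<noteq> 0" "W \<noteq> 0" using r by auto
  have q: "cmod q < 1"
  proof -
    have "r\<^sup>2 < cmod W * cmod Z"
      unfolding power2_eq_square by (rule mult_strict_mono') (use r in auto)
    then show ?thesis by (simp add: q_def norm_divide norm_mult norm_power nz)
  qed
  let ?h = "\<lambda>N s. indicator (ball 0 r) s *\<^sub>R (cnj (P W N s) * P Z N s)"
  have "(LINT s|lborel. ?h N s) = complex_of_real pi * (\<Sum>n<N. q ^ Suc n / of_nat (Suc n))" for N
  proof -
    let ?m = "\<lambda>m n s. indicator (ball 0 r) s *\<^sub>R (cnj s ^ m * s ^ n)"
    have mom: "integrable lborel (?m m n)" for m n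
    proof (rule integrable_bounded_on_disc[where B = "r ^ m * r ^ n"])
      show "cmod (cnj s ^ m * s ^ n) \<le> r ^ m * r ^ n" if "cmod s < r" for s
        using that r by (auto simp: norm_mult norm_power intro!: mult_mono power_mono)
    qed measurable
    have "(LINT s|lborel. ?h N s)
        = (LINT s|lborel. (\<Sum>m<N. \<Sum>n<N. (1 / (cnj W ^ Suc m * Z ^ Suc n)) * ?m m n s))"
    proof (rule Bochner_Integration.integral_cong[OF refl])
      fix s
      have "cnj (P W N s) * P Z N s
          = (\<Sum>m<N. \<Sum>n<N. (1 / (cnj W ^ Suc m * Z ^ Suc n)) * (cnj s ^ m * s ^ n))"
        by (simp add: P_def sum_product del: power_Suc)
      then show "?h N s = (\<Sum>m<N. \<Sum>n<N. (1 / (cnj W ^ Suc m * Z ^ Suc n)) * ?m m n s)"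
        by (simp add: scaleR_sum_right del: power_Suc)
    qed
    also have "\<dots> = (\<Sum>m<N. \<Sum>n<N. (1 / (cnj W ^ Suc m * Z ^ Suc n)) * (LINT s|lborel. ?m m n s))"
      by (subst Bochner_Integration.integral_sum, intro Bochner_Integration.integrable_sum integrable_mult_right mom,
          rule sum.cong[OF refl],
          subst Bochner_Integration.integral_sum, intro integrable_mult_right mom,
          simp only: integral_mult_right_zero)
    also have "\<dots> = (\<Sum>m<N. (1 / (cnj W ^ Suc m * Z ^ Suc m))
                        * complex_of_real (pi * (r\<^sup>2) ^ Suc m / real (Suc m)))"
      unfolding disc_moment[OF r(1)]
      by (intro sum.cong refl) (simp add: if_distrib[of "(*) _"] cong: if_cong del: power_Suc of_nat_Suc)
    also have "\<dots> = complex_of_real pi * (\<Sum>n<N. q ^ Suc n / of_nat (Suc n))"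
      by (simp add: sum_distrib_left q_def power_divide power_mult_distrib del: power_Suc of_nat_Suc)
    finally show ?thesis .
  qed
  moreover have "(\<lambda>N. complex_of_real pi * (\<Sum>n<N. q ^ Suc n / of_nat (Suc n)))
      \<longlonglongrightarrow> complex_of_real pi * (- Ln (1 - q))"
  proof -
    have "(\<lambda>n. - (q ^ n / of_nat n)) sums Ln (1 - q)"
      using Ln_series'[of "- q"] q by simp
    then have "(\<lambda>n. q ^ n / of_nat n) sums (- Ln (1 - q))"
      using sums_minus by fastforce
    then have "(\<lambda>n. q ^ Suc n / of_nat (Suc n)) sums (- Ln (1 - q))"
      by (subst sums_Suc_iff) simp
    then show ?thesis
      unfolding sums_def by (rule tendsto_mult_left)
  qed
  ultimately have lim1: "(\<lambda>N. LINT s|lborel. ?h N s) \<longlonglongrightarrow> complex_of_real pi * (- Ln (1 - q))"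
    by simp
  let ?w = "\<lambda>s. indicator (ball (0::complex) r) s *\<^sub>R (1 / (cmod W - r) * (1 / (cmod Z - r)))"
  have lim2: "(\<lambda>N. LINT s|lborel. ?h N s)
      \<longlonglongrightarrow> (LINT s|lborel. indicator (ball 0 r) s *\<^sub>R (1 / (cnj (s - W) * (s - Z))))"
  proof (rule integral_dominated_convergence[where w = ?w])
    have "integrable lborel (indicator (ball (0::complex) r) :: complex \<Rightarrow> real)"
      using r by (intro integrable_real_indicator) (auto simp: emeasure_ball)
    then show "integrable lborel ?w" by simp
    show "AE s in lborel. (\<lambda>N. ?h N s) \<longlonglongrightarrow> indicator (ball 0 r) s *\<^sub>R (1 / (cnj (s - W) * (s - Z)))"
    proof (rule AE_I2)
      fix s
      have "(\<lambda>N. cnj (P W N s) * P Z N s) \<longlonglongrightarrow> cnj (1 / (W - s)) * (1 / (Z - s))" if "cmod s < r"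
        using that r by (intro tendsto_intros P_lim) auto
      moreover have "cnj (1 / (W - s)) * (1 / (Z - s)) = 1 / (cnj (s - W) * (s - Z))"
        by (simp add: divide_simps) (auto simp: algebra_simps)
      ultimately show "(\<lambda>N. ?h N s) \<longlonglongrightarrow> indicator (ball 0 r) s *\<^sub>R (1 / (cnj (s - W) * (s - Z)))"
        by (cases "cmod s < r") (auto simp: indicator_def)
    qed
    show "AE s in lborel. norm (?h N s) \<le> ?w s" for N
    proof (rule AE_I2)
      fix s
      have "cmod (cnj (P W N s) * P Z N s) \<le> 1 / (cmod W - r) * (1 / (cmod Z - r))" if "cmod s < r"
        unfolding norm_mult complex_mod_cnj
        by (intro mult_mono P_bound that r) (use r in auto)
      then show "norm (?h N s) \<le> ?w s" by (auto simp: indicator_def)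
    qed
  qed measurable
  show ?thesis
    using LIMSEQ_unique[OF lim1 lim2] by (simp add: q_def)
qed

lemma integrable_inverse_norm_ball:
  "integrable lborel (\<lambda>u. indicator (ball c R) u / cmod (u - p))"
proof -
  define r where "r = \<bar>R\<bar> + dist c p"
  have r: "0 \<le> r" by (simp add: r_def)
  have [measurable]: "ball (0::complex) r \<in> sets borel" "ball c R \<in> sets borel"
    "ball p r \<in> sets borel" by simp_all
  have 0: "integrable lborel (\<lambda>s::complex. indicator (ball 0 r) s / cmod s)"
  proof (rule integrableI_bounded)
    have "(\<integral>\<^sup>+ s. ennreal (norm (indicator (ball 0 r) s / cmod s)) \<partial>lborel)
        = (\<integral>\<^sup>+ s. indicator (ball (0::complex) r) s * ennreal (((cmod s)\<^sup>2) powr (- (1/2))) \<partial>lborel)"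
    proof (rule nn_integral_cong)
      fix s :: complex
      show "ennreal (norm (indicator (ball 0 r) s / cmod s))
          = indicator (ball 0 r) s * ennreal (((cmod s)\<^sup>2) powr (- (1/2)))"
        by (cases "s = 0") (auto simp: indicator_def powr_minus powr_half_sqrt inverse_eq_divide)
    qed
    also have "\<dots> = ennreal pi * (\<integral>\<^sup>+ x. indicator {0<..<r\<^sup>2} x * ennreal (x powr (- (1/2))) \<partial>lborel)"
      by (rule nn_integral_radial_disc[OF r]) measurable
    also have "(\<integral>\<^sup>+ x. indicator {0<..<r\<^sup>2} x * ennreal (x powr (- (1/2))) \<partial>lborel)
        \<le> (\<integral>\<^sup>+ x. ennreal (x powr (- (1/2))) * indicator {0..r\<^sup>2} x \<partial>lborel)"
      by (intro nn_integral_mono) (auto simp: indicator_def)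
    also have "\<dots> = ennreal ((r\<^sup>2) powr (- (1/2) + 1) / (- (1/2) + 1))"
      by (rule nn_integral_has_integral_lebesgue'[OF _ has_integral_powr_from_0]) auto
    finally show "(\<integral>\<^sup>+ s. ennreal (norm (indicator (ball 0 r) s / cmod s)) \<partial>lborel) < \<infinity>"
      by (rule le_less_trans) (auto simp: mult_left_mono ennreal_mult_less_top)
  qed measurable
  have "integrable (distr lborel borel ((+) p)) (\<lambda>u. indicator (ball p r) u / cmod (u - p))"
  proof (subst integrable_distr_eq)
    have "(\<lambda>s. indicator (ball p r) (p + s) / cmod (p + s - p)) = (\<lambda>s. indicator (ball 0 r) s / cmod s)"
      by (auto simp: indicator_def dist_norm)
    then show "integrable lborel (\<lambda>s. indicator (ball p r) (p + s) / cmod (p + s - p))"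
      using 0 by simp
  qed measurable
  then have "integrable lborel (\<lambda>u. indicator (ball p r) u / cmod (u - p))"
    by (simp add: lborel_distr_plus)
  then show ?thesis
  proof (rule Bochner_Integration.integrable_bound)
    have "ball c R \<subseteq> ball p r"
    proof
      fix u assume "u \<in> ball c R"
      then show "u \<in> ball p r"
        using dist_triangle[of p u c] by (simp add: r_def dist_commute)
    qed
    then show "AE u in lborel. norm (indicator (ball c R) u / cmod (u - p))
        \<le> norm (indicator (ball p r) u / cmod (u - p))"
      by (intro AE_I2) (auto simp: indicator_def)
  qed measurable
qed

text \<open>
  The triangle inequality \<open>\<bar>z - w\<bar> \<le> \<bar>u - w\<bar> + \<bar>u - z\<bar>\<close> gives the bound
  \<open>1 / (\<bar>u - w\<bar> \<bar>u - z\<bar>) \<le> (1 / \<bar>u - w\<bar> + 1 / \<bar>u - z\<bar>) / \<bar>z - w\<bar>\<close>, which separates the two singularities.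
\<close>

lemma integrable_Cauchy_kernel_ball:
  assumes "z \<noteq> w"
  shows "integrable lborel (\<lambda>u. indicator (ball c R) u *\<^sub>R (1 / (cnj (u - w) * (u - z))))"
proof -
  have [measurable]: "ball c R \<in> sets borel" by simp
  let ?b = "\<lambda>u. (indicator (ball c R) u / cmod (u - w) + indicator (ball c R) u / cmod (u - z)) / cmod (z - w)"
  have "integrable lborel ?b"
    by (intro integrable_divide Bochner_Integration.integrable_add integrable_inverse_norm_ball)
  then show ?thesis
  proof (rule Bochner_Integration.integrable_bound)
    show "AE u in lborel. norm (indicator (ball c R) u *\<^sub>R (1 / (cnj (u - w) * (u - z)))) \<le> norm (?b u)"
    proof (rule AE_I2)
      fix u
      define p q d where "p = cmod (u - w)" and "q = cmod (u - z)" and "d = cmod (z - w)"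
      have "d \<le> p + q"
        using norm_triangle_ineq4[of "u - w" "u - z"] by (simp add: p_def q_def d_def)
      moreover have "0 < d" "0 \<le> p" "0 \<le> q" using assms by (auto simp: p_def q_def d_def)
      ultimately have "1 / (p * q) \<le> (1 / p + 1 / q) / d"
        by (cases "p = 0 \<or> q = 0") (auto simp: field_simps)
      moreover have "norm ((1 / p + 1 / q) / d) = (1 / p + 1 / q) / d"
        using \<open>0 < d\<close> \<open>0 \<le> p\<close> \<open>0 \<le> q\<close> by simp
      ultimately show "norm (indicator (ball c R) u *\<^sub>R (1 / (cnj (u - w) * (u - z)))) \<le> norm (?b u)"
        by (cases "u \<in> ball c R")
           (auto simp: norm_divide norm_mult p_def[symmetric] q_def[symmetric] d_def[symmetric]
                 simp flip: complex_cnj_diff)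
    qed
  qed measurable
qed

text \<open>
  On the boundary circle the power series of the kernel no longer converge uniformly, but the
  kernel is integrable, so the value is the limit of the values for smaller concentric discs.
  There \<open>r\<^sup>2 / (cnj W * Z)\<close> tends to \<open>W / Z\<close>, a number of modulus \<open>1\<close> other than \<open>1\<close>, and \<open>Ln\<close> is continuous
  at \<open>1 - W / Z\<close>.
\<close>

lemma integral_disc_kernel_boundary:
  assumes Z: "cmod Z = \<rho>" and W: "cmod W = \<rho>" and ZW: "Z \<noteq> W"
  shows "(LINT s|lborel. indicator (ball 0 \<rho>) s *\<^sub>R (1 / (cnj (s - W) * (s - Z))))
       = - complex_of_real pi * Ln (1 - W / Z)"
proof -
  have \<rho>: "0 < \<rho>" using Z W ZW by (metis norm_eq_zero zero_less_norm_iff)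
  have nz: "Z \<noteq> 0" "W \<noteq> 0" using \<rho> Z W by auto
  define r where "r k = \<rho> * (1 - inverse (real (Suc k)))" for k
  have r: "0 \<le> r k" "r k < \<rho>" for k
    using \<rho> by (auto simp: r_def field_simps)
  have rlim: "r \<longlonglongrightarrow> \<rho>"
    unfolding r_def[abs_def]
    using tendsto_mult[OF tendsto_const[of \<rho>] tendsto_diff[OF tendsto_const[of 1] LIMSEQ_inverse_real_of_nat]]
    by simp
  let ?k = "\<lambda>s. 1 / (cnj (s - W) * (s - Z))"
  have lim1: "(\<lambda>k. LINT s|lborel. indicator (ball 0 (r k)) s *\<^sub>R ?k s)
      \<longlonglongrightarrow> (LINT s|lborel. indicator (ball 0 \<rho>) s *\<^sub>R ?k s)"
  proof (rule integral_dominated_convergence[where w = "\<lambda>s. norm (indicator (ball 0 \<rho>) s *\<^sub>R ?k s)"])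
    show "integrable lborel (\<lambda>s. norm (indicator (ball 0 \<rho>) s *\<^sub>R ?k s))"
      by (rule integrable_norm integrable_Cauchy_kernel_ball ZW)+
    show "AE s in lborel. norm (indicator (ball 0 (r k)) s *\<^sub>R ?k s) \<le> norm (indicator (ball 0 \<rho>) s *\<^sub>R ?k s)" for k
      using r[of k] by (intro AE_I2) (auto simp: indicator_def)
    show "AE s in lborel. (\<lambda>k. indicator (ball 0 (r k)) s *\<^sub>R ?k s) \<longlonglongrightarrow> indicator (ball 0 \<rho>) s *\<^sub>R ?k s"
    proof (rule AE_I2)
      fix s :: complex
      have "\<forall>\<^sub>F k in sequentially. s \<in> ball 0 (r k) \<longleftrightarrow> s \<in> ball 0 \<rho>"
      proof (cases "cmod s < \<rho>")
        case True
        show ?thesis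
          using order_tendstoD(1)[OF rlim True] by eventually_elim (use True in auto)
      next
        case False
        then have "\<not> cmod s < r k" for k using r(2)[of k] by linarith
        then show ?thesis using False by simp
      qed
      then show "(\<lambda>k. indicator (ball 0 (r k)) s *\<^sub>R ?k s) \<longlonglongrightarrow> indicator (ball 0 \<rho>) s *\<^sub>R ?k s"
        by (intro tendsto_eventually) (auto elim!: eventually_mono simp: indicator_def)
    qed
  next
    have [measurable]: "ball 0 \<rho> \<in> sets (borel :: complex measure)"
      "ball 0 (r k) \<in> sets (borel :: complex measure)" for k by simp_all
    show "(\<lambda>s. indicator (ball 0 \<rho>) s *\<^sub>R ?k s) \<in> borel_measurable lborel"
      "(\<lambda>s. indicator (ball 0 (r k)) s *\<^sub>R ?k s) \<in> borel_measurable lborel" for k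
      by measurable
  qed
  have inner: "(LINT s|lborel. indicator (ball 0 (r k)) s *\<^sub>R ?k s)
      = - complex_of_real pi * Ln (1 - complex_of_real ((r k)\<^sup>2) / (cnj W * Z))" for k
    using r[of k] Z W by (intro integral_disc_kernel_outside) auto
  have WZ: "complex_of_real (\<rho>\<^sup>2) / (cnj W * Z) = W / Z"
  proof -
    have "complex_of_real (\<rho>\<^sup>2) = W * cnj W" using W by (simp only: complex_norm_square[symmetric])
    then show ?thesis using nz by simp
  qed
  have notin: "1 - W / Z \<notin> \<real>\<^sub>\<le>\<^sub>0"
  proof
    assume "1 - W / Z \<in> \<real>\<^sub>\<le>\<^sub>0"
    then have re: "Re (W / Z) \<ge> 1" and im: "Im (W / Z) = 0" by (auto simp: complex_nonpos_Reals_iff)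
    have "cmod (W / Z) = 1" using Z W \<rho> by (simp add: norm_divide)
    then have "Re (W / Z) = 1" using re complex_Re_le_cmod[of "W / Z"] by linarith
    with im have "W / Z = 1" by (simp add: complex_eq_iff)
    then show False using ZW nz by simp
  qed
  have "(\<lambda>k. - complex_of_real pi * Ln (1 - complex_of_real ((r k)\<^sup>2) / (cnj W * Z)))
      \<longlonglongrightarrow> - complex_of_real pi * Ln (1 - complex_of_real (\<rho>\<^sup>2) / (cnj W * Z))"
    using nz by (intro tendsto_intros rlim) (use notin WZ in auto)
  then have lim2: "(\<lambda>k. LINT s|lborel. indicator (ball 0 (r k)) s *\<^sub>R ?k s)
      \<longlonglongrightarrow> - complex_of_real pi * Ln (1 - W / Z)"
    by (simp only: inner WZ)
  show ?thesis by (rule LIMSEQ_unique[OF lim1 lim2])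
qed

lemma C_indicator_ball:
  assumes z: "dist c z = \<rho>" and w: "dist c w = \<rho>" and zw: "z \<noteq> w"
  shows "C (indicator (ball c \<rho>)) z w = Ln ((z - w) / (z - c))"
proof -
  have [measurable]: "ball c \<rho> \<in> sets borel" by simp
  have "(LINT u|lebesgue. complex_of_real (indicator (ball c \<rho>) u) / (cnj (u - w) * (u - z)))
      = (LINT u|lborel. complex_of_real (indicator (ball c \<rho>) u) / (cnj (u - w) * (u - z)))"
    by (rule integral_completion) measurable
  also have "\<dots> = (LINT u|distr lborel borel ((+) c).
      complex_of_real (indicator (ball c \<rho>) u) / (cnj (u - w) * (u - z)))"
    by (simp only: lborel_distr_plus)
  also have "\<dots> = (LINT s|lborel. complex_of_real (indicator (ball c \<rho>) (c + s)) / (cnj (c + s - w) * (c + s - z)))"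
    by (rule integral_distr) measurable
  also have "\<dots> = (LINT s|lborel. indicator (ball 0 \<rho>) s *\<^sub>R (1 / (cnj (s - (w - c)) * (s - (z - c)))))"
    by (rule Bochner_Integration.integral_cong)
       (auto simp: indicator_def dist_norm algebra_simps)
  also have "\<dots> = - complex_of_real pi * Ln (1 - (w - c) / (z - c))"
    by (rule integral_disc_kernel_boundary) (use z w zw in \<open>auto simp: dist_norm norm_minus_commute\<close>)
  also have "1 - (w - c) / (z - c) = (z - w) / (z - c)"
  proof -
    have "z \<noteq> c" using z w zw by auto
    then show ?thesis by (simp add: field_simps)
  qed
  finally show ?thesis by (simp add: C_def)
qed

section \<open>The region where the exponential is within distance one of one\<close>

text \<open>
  The lines are the tangents to the graph of \<open>b \<mapsto> ln (2 cos b)\<close>; the one with \<open>\<theta> = \<pi>/2 - b\<close> has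
  its point of contact above \<open>b\<close> and gives the second claim. If \<open>b\<close> were at least \<open>\<pi>/2\<close>, then
  small \<open>\<theta>\<close> would give \<open>a \<le> ln (2 sin \<theta>)\<close>, which tends to \<open>-\<infinity>\<close> as \<open>\<theta> \<rightarrow> 0\<close>. The case \<open>b \<le> -\<pi>/2\<close> is the
  mirror image under \<open>\<theta> \<mapsto> \<pi> - \<theta>\<close>.
\<close>

lemma support_lines_imp_strip_and_graph:
  fixes a b :: real
  assumes "\<And>\<theta>. 0 < \<theta> \<Longrightarrow> \<theta> < pi \<Longrightarrow>
             a * sin \<theta> + b * cos \<theta> \<le> ln (2 * sin \<theta>) * sin \<theta> + (pi / 2 - \<theta>) * cos \<theta>"
  shows "\<bar>b\<bar> < pi / 2" and "a \<le> ln (2 * cos b)"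
proof -
  have upper: "b' < pi / 2"
    if line: "\<And>\<theta>. 0 < \<theta> \<Longrightarrow> \<theta> < pi \<Longrightarrow>
             a * sin \<theta> + b' * cos \<theta> \<le> ln (2 * sin \<theta>) * sin \<theta> + (pi / 2 - \<theta>) * cos \<theta>" for b'
  proof (rule ccontr)
    assume b': "\<not> b' < pi / 2"
    \<comment> \<open>Small enough that \<open>2 sin \<theta> < exp a\<close>; the bound \<open>1\<close> keeps \<open>\<theta>\<close> below \<open>\<pi>/2\<close>.\<close>
    define \<theta> where "\<theta> = min 1 (exp a / 4)"
    have \<theta>: "0 < \<theta>" "\<theta> < pi / 2" "\<theta> \<le> exp a / 4"
      using pi_gt3 by (auto simp: \<theta>_def)
    then have s: "0 < sin \<theta>" and c: "0 < cos \<theta>"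
      by (auto intro!: sin_gt_zero cos_gt_zero)
    have "(pi / 2 - \<theta>) * cos \<theta> \<le> b' * cos \<theta>"
      using b' \<theta> c by (intro mult_right_mono) auto
    then have "a * sin \<theta> \<le> ln (2 * sin \<theta>) * sin \<theta>"
      using line[of \<theta>] \<theta> by auto
    then have "a \<le> ln (2 * sin \<theta>)" using s by simp
    then have "exp a \<le> 2 * sin \<theta>" using s by (simp add: ln_ge_iff)
    also have "\<dots> \<le> 2 * \<theta>" using sin_x_le_x[of \<theta>] \<theta> by simp
    also have "\<dots> \<le> exp a / 2" using \<theta> by simp
    finally show False using exp_gt_zero[of a] by linarith
  qed
  have "b < pi / 2" using assms by (rule upper)
  moreover have "- b < pi / 2"
  proof (rule upper)
    fix \<theta> :: real assume "0 < \<theta>" "\<theta> < pi"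
    then show "a * sin \<theta> + - b * cos \<theta> \<le> ln (2 * sin \<theta>) * sin \<theta> + (pi / 2 - \<theta>) * cos \<theta>"
      using assms[of "pi - \<theta>"] by (simp add: algebra_simps)
  qed
  ultimately show b: "\<bar>b\<bar> < pi / 2" by linarith
  have c: "0 < cos b" using b by (intro cos_gt_zero_pi) auto
  have "a * cos b + b * sin b \<le> ln (2 * cos b) * cos b + b * sin b"
    using assms[of "pi / 2 - b"] b by (simp add: sin_diff cos_diff)
  then show "a \<le> ln (2 * cos b)" using c by simp
qed

text \<open>
  With \<open>e = exp (Re c)\<close> this is the identity
  \<open>\<bar>1 - exp c\<bar>\<^sup>2 = 1 + e (e - 2 cos (Im c))\<close>.
\<close>

lemma cmod_one_minus_exp_le_1_iff:
  assumes b: "\<bar>Im c\<bar> < pi / 2"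
  shows "cmod (1 - exp c) \<le> 1 \<longleftrightarrow> Re c \<le> ln (2 * cos (Im c))"
    and "cmod (1 - exp c) = 1 \<longleftrightarrow> Re c = ln (2 * cos (Im c))"
proof -
  define e k where "e = exp (Re c)" and "k = cos (Im c)"
  have k: "0 < k" unfolding k_def using b by (intro cos_gt_zero_pi) auto
  have e: "0 < e" by (simp add: e_def)
  have "(cmod (1 - exp c))\<^sup>2 = (1 - e * k)\<^sup>2 + (e * sin (Im c))\<^sup>2"
    by (simp add: cmod_power2 Re_exp Im_exp e_def k_def)
  also have "\<dots> = 1 - 2 * e * k + e\<^sup>2 * (k\<^sup>2 + (sin (Im c))\<^sup>2)"
    by (simp add: power2_eq_square algebra_simps)
  also have "k\<^sup>2 + (sin (Im c))\<^sup>2 = 1" by (simp add: k_def)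
  finally have sq: "(cmod (1 - exp c))\<^sup>2 = 1 + e * (e - 2 * k)"
    by (simp add: power2_eq_square algebra_simps)
  have "cmod (1 - exp c) \<le> 1 \<longleftrightarrow> (cmod (1 - exp c))\<^sup>2 \<le> 1"
    by (simp add: abs_square_le_1)
  also have "\<dots> \<longleftrightarrow> e \<le> 2 * k" using e by (simp add: sq mult_le_0_iff)
  also have "\<dots> \<longleftrightarrow> Re c \<le> ln (2 * k)" using k by (simp add: e_def ln_ge_iff)
  finally show "cmod (1 - exp c) \<le> 1 \<longleftrightarrow> Re c \<le> ln (2 * cos (Im c))" by (simp add: k_def)
  have "cmod (1 - exp c) = 1 \<longleftrightarrow> (cmod (1 - exp c))\<^sup>2 = 1"
    by (simp add: abs_square_eq_1)
  also have "\<dots> \<longleftrightarrow> e = 2 * k" using e by (simp add: sq)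
  also have "\<dots> \<longleftrightarrow> Re c = ln (2 * k)" using k by (auto simp: e_def ln_unique)
  finally show "cmod (1 - exp c) = 1 \<longleftrightarrow> Re c = ln (2 * cos (Im c))" by (simp add: k_def)
qed

section \<open>The discs through two points\<close>

definition disc_center :: "real \<Rightarrow> complex \<Rightarrow> complex \<Rightarrow> complex" where
  "disc_center \<theta> z w = 1/2 * ((z - w) * (\<i> * complex_of_real (cot \<theta>)) + (z + w))"

definition disc_radius :: "real \<Rightarrow> complex \<Rightarrow> complex \<Rightarrow> real" where
  "disc_radius \<theta> z w = cmod (z - w) / (2 * sin \<theta>)"

lemma affine_image_D:
  assumes "z \<noteq> w"
  shows "{1/2 * ((z - w) * v + (z + w)) | v. v \<in> D \<theta>} = ball (disc_center \<theta> z w) (disc_radius \<theta> z w)"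
proof (intro equalityI subsetI)
  have dist_eq: "dist (disc_center \<theta> z w) (1/2 * ((z - w) * v + (z + w)))
      = cmod (z - w) / 2 * dist (\<i> * complex_of_real (cot \<theta>)) v" for v
  proof -
    have "disc_center \<theta> z w - 1/2 * ((z - w) * v + (z + w))
        = (z - w) / 2 * (\<i> * complex_of_real (cot \<theta>) - v)"
      by (simp add: disc_center_def field_simps)
    then show ?thesis unfolding dist_norm by (simp only: norm_mult) (simp add: norm_divide)
  qed
  have rad_eq: "disc_radius \<theta> z w = cmod (z - w) / 2 * (1 / sin \<theta>)"
    by (simp add: disc_radius_def)
  have pos: "0 < cmod (z - w) / 2" using assms by simp
  have iff: "1/2 * ((z - w) * v + (z + w)) \<in> ball (disc_center \<theta> z w) (disc_radius \<theta> z w) \<longleftrightarrow> v \<in> D \<theta>" for v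
    unfolding mem_ball D_def dist_eq rad_eq using pos by (simp only: mult_less_cancel_left_pos)
  show "u \<in> ball (disc_center \<theta> z w) (disc_radius \<theta> z w)"
    if "u \<in> {1/2 * ((z - w) * v + (z + w)) | v. v \<in> D \<theta>}" for u
    using that iff by blast
  fix u assume u: "u \<in> ball (disc_center \<theta> z w) (disc_radius \<theta> z w)"
  define v where "v = (2 * u - (z + w)) / (z - w)"
  have "u = 1/2 * ((z - w) * v + (z + w))" using assms by (simp add: v_def)
  then show "u \<in> {1/2 * ((z - w) * v + (z + w)) | v. v \<in> D \<theta>}" using u iff by blast
qed

lemma
  assumes \<theta>: "0 < \<theta>" "\<theta> < pi"
  shows dist_disc_center_left: "dist (disc_center \<theta> z w) z = disc_radius \<theta> z w"
    and dist_disc_center_right: "dist (disc_center \<theta> z w) w = disc_radius \<theta> z w"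
proof -
  have s: "0 < sin \<theta>" using \<theta> by (rule sin_gt_zero)
  have cot: "cot \<theta> * sin \<theta> = cos \<theta>" using s by (simp add: cot_def)
  have sq: "1 + (cot \<theta>)\<^sup>2 = (1 / sin \<theta>)\<^sup>2"
  proof -
    have "(sin \<theta>)\<^sup>2 + (cos \<theta>)\<^sup>2 = 1" by simp
    then show ?thesis using s by (simp add: cot_def power_divide field_simps)
  qed
  have "cmod (Complex (-1) (cot \<theta>)) = 1 / sin \<theta>" "cmod (Complex 1 (cot \<theta>)) = 1 / sin \<theta>"
    using s by (simp_all add: cmod_def sq)
  moreover have "disc_center \<theta> z w - z = (z - w) / 2 * Complex (-1) (cot \<theta>)"
     "disc_center \<theta> z w - w = (z - w) / 2 * Complex 1 (cot \<theta>)"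
    by (simp_all add: disc_center_def Complex_eq field_simps)
  ultimately show "dist (disc_center \<theta> z w) z = disc_radius \<theta> z w"
    and "dist (disc_center \<theta> z w) w = disc_radius \<theta> z w"
    unfolding dist_norm disc_radius_def by (simp_all only: norm_mult) (simp_all add: norm_divide)
qed

text \<open>
  Here \<open>z - disc_center \<theta> z w\<close> is \<open>(z - w) (sin \<theta> - \<i> cos \<theta>) / (2 sin \<theta>)\<close>, so the
  quotient inside the logarithm is \<open>2 sin \<theta>\<close> times the unit vector of argument \<open>\<pi>/2 - \<theta>\<close>.
\<close>

lemma C_extremal_disc:
  assumes \<theta>: "0 < \<theta>" "\<theta> < pi" and zw: "z \<noteq> w"
  shows "C (indicator (ball (disc_center \<theta> z w) (disc_radius \<theta> z w))) z w
       = Complex (ln (2 * sin \<theta>)) (pi / 2 - \<theta>)"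
proof -
  have s: "0 < sin \<theta>" using \<theta> by (rule sin_gt_zero)
  let ?L = "Complex (ln (2 * sin \<theta>)) (pi / 2 - \<theta>)"
  have conj: "Complex (sin \<theta>) (cos \<theta>) * Complex (sin \<theta>) (- cos \<theta>) = 1"
    by (simp add: complex_eq_iff power2_eq_square[symmetric])
  have zc: "z - disc_center \<theta> z w = (z - w) / (2 * complex_of_real (sin \<theta>)) * Complex (sin \<theta>) (- cos \<theta>)"
    using s by (simp add: disc_center_def Complex_eq cot_def field_simps)
  have "exp ?L = 2 * complex_of_real (sin \<theta>) * Complex (sin \<theta>) (cos \<theta>)"
    using s by (simp add: complex_eq_iff Re_exp Im_exp sin_diff cos_diff)
  also have "\<dots> = (z - w) / (z - disc_center \<theta> z w)"
  proof -
    have "2 * complex_of_real (sin \<theta>) * Complex (sin \<theta>) (cos \<theta>) * (z - disc_center \<theta> z w)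
        = (2 * complex_of_real (sin \<theta>)) * ((z - w) / (2 * complex_of_real (sin \<theta>)))
          * (Complex (sin \<theta>) (cos \<theta>) * Complex (sin \<theta>) (- cos \<theta>))"
      unfolding zc by (simp only: mult_ac)
    also have "\<dots> = z - w" using s by (simp add: conj)
    finally have "2 * complex_of_real (sin \<theta>) * Complex (sin \<theta>) (cos \<theta>) * (z - disc_center \<theta> z w) = z - w" .
    moreover from this have "z - disc_center \<theta> z w \<noteq> 0" using zw by auto
    ultimately show ?thesis by (simp only: eq_divide_eq if_True simp_thms)
  qed
  finally have "Ln ((z - w) / (z - disc_center \<theta> z w)) = ?L"
    using \<theta> by (intro Ln_unique) auto
  then show ?thesis
    by (subst C_indicator_ball[OF dist_disc_center_left[OF \<theta>] dist_disc_center_right[OF \<theta>] zw])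
qed

text \<open>
  This identity makes the discs extremal: in the direction \<open>sin \<theta> - \<i> cos \<theta>\<close> the kernel changes
  sign exactly across the circle of the disc with parameter \<open>\<theta>\<close>. It also holds at \<open>u = z\<close> and
  \<open>u = w\<close>, where division by zero makes both sides \<open>0\<close>.
\<close>

lemma rotated_kernel_eq:
  assumes \<theta>: "0 < \<theta>" "\<theta> < pi" and zw: "z \<noteq> w"
  shows "Re (Complex (sin \<theta>) (- cos \<theta>) * - (1 / (cnj (u - w) * (u - z))))
       = sin \<theta> * ((disc_radius \<theta> z w)\<^sup>2 - (dist (disc_center \<theta> z w) u)\<^sup>2) / (cmod ((u - w) * (u - z)))\<^sup>2"
proof -
  define s k where "s = sin \<theta>" and "k = cos \<theta>"
  have s: "0 < s" unfolding s_def using \<theta> by (rule sin_gt_zero)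
  have sk: "s * s + k * k = 1" by (simp add: s_def k_def power2_eq_square[symmetric])
  \<comment> \<open>The coordinate \<open>v\<close> places \<open>z\<close> at \<open>1\<close> and \<open>w\<close> at \<open>-1\<close>.\<close>
  define a v where "a = (z - w) / 2" and "v = (u - (z + w) / 2) / a"
  have a: "a \<noteq> 0" using zw by (simp add: a_def)
  have uv: "u = a * v + (z + w) / 2" using a by (simp add: v_def)
  have uw: "u - w = a * (v + 1)" and uz: "u - z = a * (v - 1)"
    unfolding uv by (simp_all add: a_def field_simps)
  have uc: "disc_center \<theta> z w - u = a * (\<i> * complex_of_real (k / s) - v)"
    unfolding uv disc_center_def cot_def by (simp add: a_def s_def k_def field_simps)
  have rad: "disc_radius \<theta> z w = cmod a / s"
    by (simp add: disc_radius_def a_def s_def norm_divide)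
  obtain x y where v: "v = Complex x y" by (cases v)
  have num: "Re (Complex s (- k) * - ((u - w) * cnj (u - z)))
      = s * ((disc_radius \<theta> z w)\<^sup>2 - (dist (disc_center \<theta> z w) u)\<^sup>2)"
  proof -
    have "(u - w) * cnj (u - z) = (a * cnj a) * ((v + 1) * cnj (v - 1))"
      by (simp add: uw uz)
    also have "a * cnj a = complex_of_real ((cmod a)\<^sup>2)" by (rule complex_norm_square[symmetric])
    finally have "(u - w) * cnj (u - z) = complex_of_real ((cmod a)\<^sup>2) * ((v + 1) * cnj (v - 1))" .
    moreover have "Re (p * - (complex_of_real r * q)) = r * Re (p * - q)" for p q r
      by (simp add: algebra_simps)
    ultimately have "Re (Complex s (- k) * - ((u - w) * cnj (u - z)))
        = (cmod a)\<^sup>2 * Re (Complex s (- k) * - ((v + 1) * cnj (v - 1)))"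
      by (simp only:)
    also have "Re (Complex s (- k) * - ((v + 1) * cnj (v - 1))) = s * (1 - x * x - y * y) + 2 * k * y"
      by (simp add: v algebra_simps)
    also have "\<dots> = s * (1 / s * (1 / s) - (x * x + (k / s - y) * (k / s - y)))"
    proof -
      have "s * (1 / s * (1 / s) - (x * x + (k / s - y) * (k / s - y)))
          = (1 - k * k) / s - s * (x * x + y * y) + 2 * k * y"
        using s by (simp add: field_simps)
      also have "1 - k * k = s * s" using sk by simp
      also have "s * s / s - s * (x * x + y * y) + 2 * k * y = s * (1 - x * x - y * y) + 2 * k * y"
        using s by (simp add: right_diff_distrib distrib_left)
      finally show ?thesis by (rule sym)
    qed
    also have "x * x + (k / s - y) * (k / s - y) = (cmod (\<i> * complex_of_real (k / s) - v))\<^sup>2"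
      by (simp only: cmod_power2) (simp add: v power2_eq_square)
    finally have "Re (Complex s (- k) * - ((u - w) * cnj (u - z)))
        = (cmod a)\<^sup>2 * (s * (1 / s * (1 / s) - (cmod (\<i> * complex_of_real (k / s) - v))\<^sup>2))" .
    moreover have "dist (disc_center \<theta> z w) u = cmod a * cmod (\<i> * complex_of_real (k / s) - v)"
      unfolding dist_norm uc by (rule norm_mult)
    moreover have "A\<^sup>2 * (s * (1 / s * (1 / s) - N\<^sup>2)) = s * ((A / s)\<^sup>2 - (A * N)\<^sup>2)" for A N
      by (simp add: power2_eq_square algebra_simps)
    ultimately show ?thesis by (simp only: rad)
  qed
  have inv: "1 / (cnj p * q) = p * cnj q / complex_of_real ((cmod (p * q))\<^sup>2)" for p q :: complex
  proof -
    have "complex_of_real ((cmod (p * q))\<^sup>2) = (cnj p * q) * (p * cnj q)"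
      by (simp only: complex_norm_square complex_cnj_mult mult_ac)
    then show ?thesis by (cases "p = 0 \<or> q = 0") auto
  qed
  have "Complex s (- k) * - (1 / (cnj (u - w) * (u - z)))
      = (Complex s (- k) * - ((u - w) * cnj (u - z))) / complex_of_real ((cmod ((u - w) * (u - z)))\<^sup>2)"
    by (simp only: inv) simp
  then have "Re (Complex s (- k) * - (1 / (cnj (u - w) * (u - z))))
      = Re (Complex s (- k) * - ((u - w) * cnj (u - z))) / (cmod ((u - w) * (u - z)))\<^sup>2"
    by (simp only: Re_divide_of_real)
  then show ?thesis unfolding s_def[symmetric] k_def[symmetric] by (simp only: num)
qed

section \<open>The discs as extremal weights\<close>

text \<open>
  The complement of the essential support is a union of open sets on which \<open>g\<close> vanishes almost
  everywhere, and by second countability a countable subfamily has the same union.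
\<close>

lemma AE_zero_outside_ess_support: "AE u in lebesgue. u \<notin> ess_support g \<longrightarrow> g u = 0"
proof -
  let ?\<F> = "{U. open U \<and> (AE u in lebesgue. u \<in> U \<longrightarrow> g u = 0)}"
  obtain \<F>' where \<F>': "\<F>' \<subseteq> ?\<F>" "countable \<F>'" "\<Union>\<F>' = \<Union>?\<F>"
    by (rule Lindelof[of ?\<F>]) auto
  have "AE u in lebesgue. \<forall>U\<in>\<F>'. u \<in> U \<longrightarrow> g u = 0"
    using \<F>'(1,2) by (subst AE_ball_countable) auto
  then show ?thesis
  proof eventually_elim
    case (elim u)
    have "u \<notin> ess_support g \<longleftrightarrow> u \<in> \<Union>\<F>'" unfolding ess_support_def \<F>'(3) by blast
    with elim show ?case by blast
  qed
qed

lemma G1_bounded_support: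
  assumes "g \<in> G1"
  obtains R where "AE u in lebesgue. \<bar>g u\<bar> \<le> indicator (ball 0 R) u"
proof -
  have "bounded (ess_support g)"
    using assms by (auto simp: G1_def intro: compact_imp_bounded)
  then obtain R where R: "ess_support g \<subseteq> ball 0 R"
    using bounded_subset_ballD by blast
  have "AE u in lebesgue. 0 \<le> g u \<and> g u \<le> 1" using assms by (simp add: G1_def)
  then have "AE u in lebesgue. \<bar>g u\<bar> \<le> indicator (ball 0 R) u"
    using AE_zero_outside_ess_support[of g]
  proof eventually_elim
    case (elim u)
    then show ?case using R by (cases "u \<in> ball 0 R") auto
  qed
  then show ?thesis by (rule that)
qed

lemma borel_measurable_mult_Cauchy_kernel:
  assumes [measurable]: "f \<in> borel_measurable lebesgue"
  shows "(\<lambda>u. complex_of_real (f u) / (cnj (u - w) * (u - z))) \<in> borel_measurable lebesgue"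
proof -
  have [measurable]: "(\<lambda>u. 1 / (cnj (u - w) * (u - z))) \<in> borel_measurable lebesgue"
    by (rule measurable_completion) measurable
  have "(\<lambda>u. complex_of_real (f u) * (1 / (cnj (u - w) * (u - z)))) \<in> borel_measurable lebesgue"
    by measurable
  then show ?thesis by simp
qed

lemma integrable_G1_Cauchy_kernel:
  assumes g: "g \<in> G1" and zw: "z \<noteq> w"
  shows "integrable lebesgue (\<lambda>u. complex_of_real (g u) / (cnj (u - w) * (u - z)))"
proof -
  obtain R where R: "AE u in lebesgue. \<bar>g u\<bar> \<le> indicator (ball 0 R) u"
    using G1_bounded_support[OF g] .
  have "g \<in> borel_measurable lebesgue" using g by (simp add: G1_def)
  let ?k = "\<lambda>u. indicator (ball 0 R) u *\<^sub>R (1 / (cnj (u - w) * (u - z)))"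
  have "integrable lebesgue ?k"
    using integrable_Cauchy_kernel_ball[OF zw, of 0 R]
    by (subst integrable_completion) (auto dest: borel_measurable_integrable)
  then show ?thesis
  proof (rule Bochner_Integration.integrable_bound)
    show "AE u in lebesgue. norm (complex_of_real (g u) / (cnj (u - w) * (u - z))) \<le> norm (?k u)"
      using R
    proof eventually_elim
      case (elim u)
      then show ?case
        by (cases "u \<in> ball 0 R") (auto simp: norm_divide intro!: divide_right_mono)
    qed
  qed (intro borel_measurable_mult_Cauchy_kernel, fact)
qed

lemma AE_lebesgue_notin_sphere: "AE u in lebesgue. u \<notin> sphere (c::complex) r"
  by (rule AE_not_in) (simp add: negligible_sphere flip: negligible_iff_null_sets)

text \<open>
  Let \<open>\<kappa>\<close> be the real part of the kernel in the direction \<open>\<mu>\<close>. Since \<open>\<kappa>\<close> is nonnegative on \<open>E\<close> and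
  nonpositive elsewhere, \<open>h = (indicator E - g) \<kappa>\<close> is nonnegative for every \<open>g\<close> with values in
  \<open>[0, 1]\<close>, and its integral is \<open>\<pi>\<close> times the gap between the two sides. If the gap is
  \<open>0\<close>, then \<open>h\<close> vanishes almost everywhere; \<open>\<kappa>\<close> is nonzero off the boundary circle,
  which is a null set, so \<open>g\<close> must agree with the indicator function.
\<close>

lemma C_extremal_inequality:
  assumes g: "g \<in> G1" and zw: "z \<noteq> w" and \<theta>: "0 < \<theta>" "\<theta> < pi"
  defines "E \<equiv> ball (disc_center \<theta> z w) (disc_radius \<theta> z w)"
  shows "Re (C g z w) * sin \<theta> + Im (C g z w) * cos \<theta>
       \<le> ln (2 * sin \<theta>) * sin \<theta> + (pi / 2 - \<theta>) * cos \<theta>"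
    and "Re (C g z w) * sin \<theta> + Im (C g z w) * cos \<theta>
           = ln (2 * sin \<theta>) * sin \<theta> + (pi / 2 - \<theta>) * cos \<theta>
         \<Longrightarrow> AE u in lebesgue. g u = indicator E u"
proof -
  define c \<rho> where "c = disc_center \<theta> z w" and "\<rho> = disc_radius \<theta> z w"
  have s: "0 < sin \<theta>" using \<theta> by (rule sin_gt_zero)
  have \<rho>: "0 < \<rho>" using s zw by (simp add: \<rho>_def disc_radius_def)
  define \<mu> where "\<mu> = Complex (sin \<theta>) (- cos \<theta>)"
  define \<kappa> where "\<kappa> u = Re (\<mu> * - (1 / (cnj (u - w) * (u - z))))" for u
  have \<kappa>: "\<kappa> u = sin \<theta> * (\<rho>\<^sup>2 - (dist c u)\<^sup>2) / (cmod ((u - w) * (u - z)))\<^sup>2" for u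
    unfolding \<kappa>_def \<mu>_def \<rho>_def c_def using \<theta> zw by (rule rotated_kernel_eq)
  have \<kappa>_in: "0 \<le> \<kappa> u" if "u \<in> E" for u
  proof -
    have "(dist c u)\<^sup>2 \<le> \<rho>\<^sup>2" using that by (intro power_mono) (auto simp: E_def c_def \<rho>_def)
    then show ?thesis unfolding \<kappa> using s by simp
  qed
  have \<kappa>_out: "\<kappa> u \<le> 0" if "u \<notin> E" for u
  proof -
    have "\<rho>\<^sup>2 \<le> (dist c u)\<^sup>2" using that \<rho> by (intro power_mono) (auto simp: E_def c_def \<rho>_def)
    then show ?thesis unfolding \<kappa> using s by (simp add: divide_le_0_iff mult_le_0_iff)
  qed
  have \<kappa>_nz: "\<kappa> u \<noteq> 0" if "u \<notin> sphere c \<rho>" for u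
  proof -
    have "u \<noteq> z" "u \<noteq> w"
      using that dist_disc_center_left[OF \<theta>] dist_disc_center_right[OF \<theta>]
      by (auto simp: c_def \<rho>_def)
    moreover have "(dist c u)\<^sup>2 \<noteq> \<rho>\<^sup>2" using that \<rho> by auto
    ultimately show ?thesis unfolding \<kappa> using s by simp
  qed
  have [measurable]: "E \<in> sets borel" by (simp add: E_def)
  have EG: "indicator E \<in> G1"
  proof -
    have "ess_support (indicator E) \<subseteq> closure E"
    proof -
      have "open (- closure E)" by (rule open_Compl[OF closed_closure])
      moreover have "AE u in lebesgue. u \<in> - closure E \<longrightarrow> indicator E u = (0::real)"
        using closure_subset[of E] by (intro AE_I2) (auto simp: indicator_def)
      ultimately show ?thesis unfolding ess_support_def by blast
    qed
    moreover have "closed (ess_support (indicator E))"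
      unfolding ess_support_def by (intro closed_Compl open_Union) auto
    moreover have "bounded (closure E)" by (simp add: E_def bounded_closure)
    ultimately have "compact (ess_support (indicator E))"
      using bounded_subset compact_eq_bounded_closed by blast
    moreover have "indicator E \<in> borel_measurable lebesgue"
      by (rule borel_measurable_indicator) (simp add: E_def)
    ultimately show ?thesis by (simp add: G1_def)
  qed
  have lin: "integrable lebesgue (\<lambda>u. f u * \<kappa> u)
      \<and> (LINT u|lebesgue. f u * \<kappa> u) = pi * Re (\<mu> * C f z w)" if f: "f \<in> G1" for f
  proof -
    have Re_of_real_mult: "Re (complex_of_real r * x) = r * Re x" for r x by simp
    let ?k = "\<lambda>u. complex_of_real (f u) / (cnj (u - w) * (u - z))"
    have int: "integrable lebesgue (\<lambda>u. - \<mu> * ?k u)"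
      by (intro integrable_mult_right integrable_G1_Cauchy_kernel f zw)
    have eq: "f u * \<kappa> u = Re (- \<mu> * ?k u)" for u
    proof -
      have "- \<mu> * ?k u = complex_of_real (f u) * (\<mu> * - (1 / (cnj (u - w) * (u - z))))" by simp
      then show ?thesis by (simp only: \<kappa>_def Re_of_real_mult)
    qed
    have "(LINT u|lebesgue. - \<mu> * ?k u) = - \<mu> * (LINT u|lebesgue. ?k u)"
      by (rule integral_mult_right_zero)
    also have "(LINT u|lebesgue. ?k u) = - complex_of_real pi * C f z w"
      by (simp add: C_def)
    finally have "(LINT u|lebesgue. - \<mu> * ?k u) = complex_of_real pi * (\<mu> * C f z w)"
      by (simp add: mult_ac)
    then have "(LINT u|lebesgue. Re (- \<mu> * ?k u)) = pi * Re (\<mu> * C f z w)"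
      by (subst integral_Re[OF int]) (simp only: Re_of_real_mult)
    moreover have "integrable lebesgue (\<lambda>u. Re (- \<mu> * ?k u))"
      by (rule integrable_Re[OF int])
    ultimately show ?thesis by (simp only: eq simp_thms)
  qed
  define h where "h u = indicator E u * \<kappa> u - g u * \<kappa> u" for u
  have h_int: "integrable lebesgue h"
    unfolding h_def using lin[OF EG] lin[OF g] by (intro Bochner_Integration.integrable_diff) auto
  have "(LINT u|lebesgue. h u) = pi * (Re (\<mu> * C (indicator E) z w) - Re (\<mu> * C g z w))"
    unfolding h_def using lin[OF EG] lin[OF g]
    by (subst Bochner_Integration.integral_diff) (auto simp: right_diff_distrib)
  also have "Re (\<mu> * C (indicator E) z w) = ln (2 * sin \<theta>) * sin \<theta> + (pi / 2 - \<theta>) * cos \<theta>"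
    unfolding E_def C_extremal_disc[OF \<theta> zw] by (simp add: \<mu>_def algebra_simps)
  also have "Re (\<mu> * C g z w) = Re (C g z w) * sin \<theta> + Im (C g z w) * cos \<theta>"
    by (simp add: \<mu>_def algebra_simps)
  finally have h_val: "(LINT u|lebesgue. h u)
      = pi * (ln (2 * sin \<theta>) * sin \<theta> + (pi / 2 - \<theta>) * cos \<theta>
              - (Re (C g z w) * sin \<theta> + Im (C g z w) * cos \<theta>))" .
  have h_nn: "AE u in lebesgue. 0 \<le> h u"
  proof -
    have "AE u in lebesgue. 0 \<le> g u \<and> g u \<le> 1" using g by (simp add: G1_def)
    then show ?thesis
    proof eventually_elim
      case (elim u)
      show ?case
      proof (cases "u \<in> E")
        case True
        then show ?thesis using elim \<kappa>_in[OF True] by (simp add: h_def mult_left_le_one_le)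
      next
        case False
        then show ?thesis using elim \<kappa>_out[OF False] by (simp add: h_def mult_nonneg_nonpos)
      qed
    qed
  qed
  have "0 \<le> (LINT u|lebesgue. h u)" using h_nn by (rule integral_nonneg_AE)
  then show "Re (C g z w) * sin \<theta> + Im (C g z w) * cos \<theta>
       \<le> ln (2 * sin \<theta>) * sin \<theta> + (pi / 2 - \<theta>) * cos \<theta>"
    unfolding h_val using pi_gt_zero by (simp only: zero_le_mult_iff) linarith
  assume "Re (C g z w) * sin \<theta> + Im (C g z w) * cos \<theta>
           = ln (2 * sin \<theta>) * sin \<theta> + (pi / 2 - \<theta>) * cos \<theta>"
  then have "(LINT u|lebesgue. h u) = 0" unfolding h_val by simp
  then have "AE u in lebesgue. h u = 0"
    using integral_nonneg_eq_0_iff_AE[OF h_int h_nn] by simp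
  then show "AE u in lebesgue. g u = indicator E u"
    using AE_lebesgue_notin_sphere[of c \<rho>]
  proof eventually_elim
    case (elim u)
    have "(indicator E u - g u) * \<kappa> u = 0" using elim(1) by (simp add: h_def left_diff_distrib)
    then show ?case using \<kappa>_nz[OF elim(2)] by simp
  qed
qed

lemma C_cong_AE:
  assumes "g \<in> borel_measurable lebesgue" "f \<in> borel_measurable lebesgue"
    and "AE u in lebesgue. g u = f u"
  shows "C g z w = C f z w"
proof -
  have "(LINT u|lebesgue. complex_of_real (g u) / (cnj (u - w) * (u - z)))
      = (LINT u|lebesgue. complex_of_real (f u) / (cnj (u - w) * (u - z)))"
    by (intro integral_cong_AE borel_measurable_mult_Cauchy_kernel assms(1,2))
       (use assms(3) in eventually_elim, simp)
  then show ?thesis by (simp add: C_def)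
qed

section \<open>The bound and the case of equality\<close>

lemma exp_C_diagonal_bound:
  assumes "g \<in> G1"
  shows "cmod (1 - exp_C g w w) \<le> 1"
proof -
  define I where "I = (LINT u|lebesgue. g u / (cmod (u - w))\<^sup>2)"
  have "AE u in lebesgue. 0 \<le> g u \<and> g u \<le> 1" using assms by (simp add: G1_def)
  then have "0 \<le> I" unfolding I_def by (intro integral_nonneg_AE) (auto elim!: eventually_mono)
  then have "exp (- (1 / pi) * I) \<le> 1" by simp
  moreover have "0 < exp (- (1 / pi) * I)" by simp
  ultimately have "\<bar>1 - exp (- (1 / pi) * I)\<bar> \<le> 1" by linarith
  moreover have "1 - complex_of_real x = complex_of_real (1 - x)" for x by simp
  ultimately have "cmod (1 - complex_of_real (exp (- (1 / pi) * I))) \<le> 1"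
    by (simp only: norm_of_real)
  then show ?thesis by (simp add: exp_C_def I_def[symmetric])
qed

theorem corollary2p6:
  fixes g :: "complex \<Rightarrow> real"
  assumes "g \<in> G1"
  shows "(\<forall>z w. cmod (1 - exp_C g z w) \<le> 1) \<and>
         (\<forall>z w. z \<noteq> w \<longrightarrow>
            (cmod (1 - exp_C g z w) = 1 \<longleftrightarrow>
             (\<exists>\<theta>\<in>{0<..<pi}. AE u in lebesgue.
                g u = indicator {1/2 * ((z - w) * v + (z + w)) | v. v \<in> D \<theta>} u)))"
proof -
  have strip: "\<bar>Im (C g z w)\<bar> < pi / 2" if "z \<noteq> w" for z w
    using C_extremal_inequality(1)[OF assms that] by (rule support_lines_imp_strip_and_graph(1))
  have graph: "Re (C g z w) \<le> ln (2 * cos (Im (C g z w)))" if "z \<noteq> w" for z w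
    using C_extremal_inequality(1)[OF assms that] by (rule support_lines_imp_strip_and_graph(2))
  have bound: "cmod (1 - exp_C g z w) \<le> 1" for z w
  proof (cases "z = w")
    case True
    then show ?thesis using exp_C_diagonal_bound[OF assms] by simp
  next
    case False
    then show ?thesis
      using cmod_one_minus_exp_le_1_iff(1)[OF strip[OF False]] graph[OF False] by (simp add: exp_C_def)
  qed
  have equality: "cmod (1 - exp_C g z w) = 1 \<longleftrightarrow>
      (\<exists>\<theta>\<in>{0<..<pi}. AE u in lebesgue. g u = indicator {1/2 * ((z - w) * v + (z + w)) | v. v \<in> D \<theta>} u)"
    if zw: "z \<noteq> w" for z w
  proof -
    define b where "b = Im (C g z w)"
    have b: "\<bar>b\<bar> < pi / 2" using strip[OF zw] by (simp add: b_def)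
    have "cmod (1 - exp_C g z w) = 1 \<longleftrightarrow> Re (C g z w) = ln (2 * cos b)"
      using cmod_one_minus_exp_le_1_iff(2)[OF strip[OF zw]] zw by (simp add: exp_C_def b_def)
    also have "\<dots> \<longleftrightarrow> (\<exists>\<theta>\<in>{0<..<pi}. AE u in lebesgue.
        g u = indicator (ball (disc_center \<theta> z w) (disc_radius \<theta> z w)) u)"
    proof
      assume a: "Re (C g z w) = ln (2 * cos b)"
      \<comment> \<open>The tangent that touches the curve at \<open>C g z w\<close>.\<close>
      define \<theta> where "\<theta> = pi / 2 - b"
      have \<theta>: "0 < \<theta>" "\<theta> < pi" using b by (auto simp: \<theta>_def)
      have "sin \<theta> = cos b" "cos \<theta> = sin b" by (simp_all add: \<theta>_def sin_diff cos_diff)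
      then have "Re (C g z w) * sin \<theta> + Im (C g z w) * cos \<theta>
          = ln (2 * sin \<theta>) * sin \<theta> + (pi / 2 - \<theta>) * cos \<theta>"
        using a by (simp add: \<theta>_def b_def[symmetric])
      then show "\<exists>\<theta>\<in>{0<..<pi}. AE u in lebesgue.
          g u = indicator (ball (disc_center \<theta> z w) (disc_radius \<theta> z w)) u"
        using C_extremal_inequality(2)[OF assms zw \<theta>] \<theta> by auto
    next
      assume "\<exists>\<theta>\<in>{0<..<pi}. AE u in lebesgue.
          g u = indicator (ball (disc_center \<theta> z w) (disc_radius \<theta> z w)) u"
      then obtain \<theta> where \<theta>: "0 < \<theta>" "\<theta> < pi"
        and "AE u in lebesgue. g u = indicator (ball (disc_center \<theta> z w) (disc_radius \<theta> z w)) u"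
        by auto
      then have "C g z w = C (indicator (ball (disc_center \<theta> z w) (disc_radius \<theta> z w))) z w"
        using assms by (intro C_cong_AE borel_measurable_indicator) (auto simp: G1_def)
      then have "C g z w = Complex (ln (2 * sin \<theta>)) (pi / 2 - \<theta>)"
        using C_extremal_disc[OF \<theta> zw] by simp
      then show "Re (C g z w) = ln (2 * cos b)" by (simp add: b_def cos_diff)
    qed
    finally show ?thesis by (simp only: affine_image_D[OF zw])
  qed
  show ?thesis using bound equality by blast
qed

end
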